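(* Let $b_p,\overline b_p,b_n,\overline b_n,c_p,\overline c_p,c_n,\overline c_n>0$ satisfy $\overline b_p\ge b_p>\overline b_p/2$, $c_p=\overline c_p$, $c_n=\overline c_n$ and $\overline b_n\le b_n$. Define, for $x>0$, $$\Upsilon_+(x)=\overline c_p\,E_1\!\big(E_1^{-1}(x/c_p)\,b_p/\overline b_p\big)-x,\qquad \Upsilon_-(x)=-\overline c_n\,E_1\!\big(E_1^{-1}(x/c_n)\,b_n/\overline b_n\big)+x,$$ and $\Upsilon_\pm(0)=0$. Then $\Upsilon_+$ and $\Upsilon_-$ are bounded, increasing (in the weak sense) and concave on $[0,\infty)$, they satisfy $$\int_{(0,\infty)}\frac{\Upsilon_\pm(y)}{2y^{3/2}}\,dy<\infty,$$ and $\Upsilon_-(x)\le x$ for every $x\ge0$.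
   Context: $E_1(x)=\int_x^\infty \frac{e^{-t}}{t}\,dt$ for $x>0$ is the exponential integral, a decreasing bijection of $(0,\infty)$ onto $(0,\infty)$, and $E_1^{-1}$ is its inverse. *)

theory Defs
  imports "HOL-Analysis.Analysis"
begin

text \<open>The exponential integral; only its values at \<open>x > 0\<close>, where the integral converges, are
  meaningful.\<close>

definition E1 :: "real \<Rightarrow> real" where
  "E1 x = (LBINT t:{x..}. exp (- t) / t)"

text \<open>The inverse of \<^const>\<open>E1\<close> as a bijection of the open half-line \<open>{0<..}\<close> onto itself,
  meaningful for positive arguments only.\<close>

definition E1_inv :: "real \<Rightarrow> real" where
  "E1_inv = the_inv_into {0<..} E1"

text \<open>In both functions the arguments \<open>cbar\<close> and \<open>bbar\<close> stand for the overlined parameters. The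
  value 0 at negative arguments is a mere convention: the functions live on \<open>{0..}\<close>.\<close>

definition Upsilon_plus :: "real \<Rightarrow> real \<Rightarrow> real \<Rightarrow> real \<Rightarrow> real \<Rightarrow> real" where
  "Upsilon_plus b bbar c cbar x =
     (if x > 0 then cbar * E1 (E1_inv (x / c) * b / bbar) - x else 0)"

definition Upsilon_minus :: "real \<Rightarrow> real \<Rightarrow> real \<Rightarrow> real \<Rightarrow> real \<Rightarrow> real" where
  "Upsilon_minus b bbar c cbar x =
     (if x > 0 then - cbar * E1 (E1_inv (x / c) * b / bbar) + x else 0)"

end

theory Submission
  imports Defs
begin

text \<open>With \<open>u = E1_inv (x / c)\<close> and \<open>k = b / bbar\<close>, the inverse function rule gives the derivative
  \<open>exp ((1 - k) * u)\<close> for \<open>x \<mapsto> c * E1 (k * u)\<close>. As \<open>u\<close> decreases in \<open>x\<close>, this is at least 1 and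
  decreasing if \<open>k \<le> 1\<close>, at most 1 and increasing if \<open>k \<ge> 1\<close>, whence monotonicity and concavity.
  Boundedness holds because \<open>E1 + ln\<close> is increasing, so that \<open>E1\<close> at \<open>u\<close> and at \<open>k * u\<close> differ by at
  most \<open>\<bar>ln k\<bar>\<close>; it settles integrability at infinity. Near 0 the function \<open>Upsilon_minus\<close> is at most \<open>x\<close>,
  while \<open>E1 (k * u) \<le> C * E1 u powr k\<close> bounds \<open>Upsilon_plus\<close> by a multiple of \<open>x powr k\<close>, and
  \<open>k > 1 / 2\<close> makes \<open>x powr (k - 3 / 2)\<close> integrable there.\<close>

section \<open>Convergence and size of the integral defining \<open>E1\<close>\<close>

text \<open>Bridge from gauge integrals to Lebesgue integrals: nonnegativity makes integrability
  absolute, which is a statement about the completed measure, and Borel measurability brings it back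
  to \<open>lborel\<close>.\<close>

lemma nonneg_integrable_on_imp_set_integrable_lborel:
  fixes f :: "real \<Rightarrow> real"
  assumes "f integrable_on A" "\<And>x. x \<in> A \<Longrightarrow> 0 \<le> f x" "set_borel_measurable lborel A f"
  shows "set_integrable lborel A f"
  using nonnegative_absolutely_integrable_1[OF assms(1,2)] assms(3)
  unfolding set_integrable_def set_borel_measurable_def by (simp add: integrable_completion)

lemma set_integrable_exp_minus: "set_integrable lborel {x..} (\<lambda>t::real. exp (- t))"
proof (rule nonneg_integrable_on_imp_set_integrable_lborel)
  show "(\<lambda>t::real. exp (- t)) integrable_on {x..}"
    using has_integral_exp_minus_to_infinity[of 1 x] by (simp add: integrable_on_def) blast
qed (auto simp: set_borel_measurable_def)

lemma exp_minus_integral: "(LBINT t:{x..}. exp (- t)) = exp (- x :: real)"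
  using set_borel_integral_eq_integral(2)[OF set_integrable_exp_minus]
    has_integral_exp_minus_to_infinity[of 1 x]
  by (simp add: integral_unique)

lemma E1_integrand_le:
  assumes "0 < x" "x \<le> t"
  shows "exp (- t) / t \<le> exp (- t) / (x :: real)"
  using assms by (intro divide_left_mono) auto

lemma set_integrable_E1:
  assumes "0 < x"
  shows "set_integrable lborel {x..} (\<lambda>t::real. exp (- t) / t)"
proof (rule set_integrable_bound[OF set_integrable_divide])
  show "AE t in lborel. t \<in> {x..} \<longrightarrow> norm (exp (- t) / t) \<le> norm (exp (- t) / x)"
    using E1_integrand_le[OF assms] assms by auto
qed (auto simp: set_borel_measurable_def set_integrable_exp_minus)

lemma E1_le: "0 < x \<Longrightarrow> E1 x \<le> exp (- x) / x"
  unfolding E1_def using set_integral_mono[OF set_integrable_E1[of x]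
      set_integrable_divide[OF set_integrable_exp_minus, of x x]]
  by (simp add: E1_integrand_le exp_minus_integral)

lemma E1_nonneg: "0 < x \<Longrightarrow> 0 \<le> E1 x"
  unfolding E1_def set_lebesgue_integral_def
  by (intro Bochner_Integration.integral_nonneg) (auto simp: indicator_def)

section \<open>Calculus of \<open>E1\<close> and comparison with the logarithm\<close>

text \<open>Confines the dependence on the lower limit to a compact interval, where the fundamental
  theorem of calculus applies.\<close>

lemma E1_split:
  assumes "0 < x" "x \<le> y"
  shows "E1 x = integral {x..y} (\<lambda>t. exp (- t) / t) + E1 y"
proof -
  let ?g = "\<lambda>t::real. exp (- t) / t"
  have E: "E1 z = integral {z..} ?g" "?g integrable_on {z..}" if "0 < z" for z
    using set_borel_integral_eq_integral[OF set_integrable_E1[OF that]] by (auto simp: E1_def)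
  have "?g integrable_on {x..y}"
    using assms by (intro integrable_continuous_interval continuous_intros) auto
  \<comment> \<open>The two pieces share a single point, a negligible set, so the integrals
    add.\<close>
  moreover have "{x..y} \<inter> {y..} = {y}" "{x..y} \<union> {y..} = {x..}"
    using assms by auto
  ultimately have "(?g has_integral (integral {x..y} ?g + integral {y..} ?g)) {x..}"
    using has_integral_Un[of ?g _ "{x..y}" _ "{y..}"] E(2)[of y] assms
    by (simp add: integrable_integral)
  then show ?thesis
    using E(1)[of x] E(1)[of y] assms by (simp add: integral_unique)
qed

lemma E1_deriv:
  assumes "0 < x"
  shows "(E1 has_real_derivative - (exp (- x) / x)) (at x)"
proof -
  let ?g = "\<lambda>t::real. exp (- t) / t"
  \<comment> \<open>\<open>{x/2..x+1}\<close> has \<open>x\<close> in its interior and avoids the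
    singularity at 0; the tail \<open>E1 (x+1)\<close> is a constant.\<close>
  have "((\<lambda>t. integral {t..x+1} ?g) has_real_derivative - ?g x) (at x within {x/2..x+1})"
    using assms by (intro integral_has_real_derivative' continuous_intros) auto
  then have "((\<lambda>t. integral {t..x+1} ?g + E1 (x+1)) has_real_derivative - ?g x) (at x)"
    using assms by (auto simp: at_within_Icc_at intro!: derivative_eq_intros)
  then show ?thesis
    by (rule has_field_derivative_transform_within_open[where S = "{x/2<..<x+1}"])
       (use assms in \<open>auto intro!: E1_split[symmetric]\<close>)
qed

lemmas E1_deriv' [derivative_intros] = DERIV_chain2[OF E1_deriv]

lemma E1_isCont: "0 < x \<Longrightarrow> isCont E1 x"
  using E1_deriv DERIV_isCont by blast

lemma E1_strict_antimono:
  assumes "0 < x" "x < y"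
  shows "E1 y < E1 x"
proof (rule DERIV_neg_imp_decreasing[OF assms(2)])
  fix t assume "x \<le> t" "t \<le> y"
  then show "\<exists>d. (E1 has_real_derivative d) (at t) \<and> d < 0"
    using assms by (intro exI[of _ "- (exp (- t) / t)"]) (auto intro: E1_deriv)
qed

lemma E1_antimono: "0 < x \<Longrightarrow> x \<le> y \<Longrightarrow> E1 y \<le> E1 x"
  using E1_strict_antimono[of x y] by (cases "x = y") auto

lemma E1_less_iff: "0 < x \<Longrightarrow> 0 < y \<Longrightarrow> E1 x < E1 y \<longleftrightarrow> y < x"
  using E1_strict_antimono[of y x] E1_antimono[of x y] by linarith

lemma E1_pos: "0 < x \<Longrightarrow> 0 < E1 x"
  using E1_strict_antimono[of x "x + 1"] E1_nonneg[of "x + 1"] by simp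

lemma E1_diff_le_ln:
  assumes "0 < x" "x \<le> y"
  shows "E1 x - E1 y \<le> ln y - ln x"
proof -
  have "(\<lambda>t. E1 t + ln t) x \<le> (\<lambda>t. E1 t + ln t) y"
  proof (rule DERIV_nonneg_imp_nondecreasing[OF assms(2)])
    fix t assume t: "x \<le> t" "t \<le> y"
    then have "((\<lambda>t. E1 t + ln t) has_real_derivative (1 - exp (- t)) / t) (at t)"
      using assms by (auto intro!: derivative_eq_intros simp: field_simps)
    then show "\<exists>d. ((\<lambda>t. E1 t + ln t) has_real_derivative d) (at t) \<and> d \<ge> 0"
      using t assms by (intro exI[of _ "(1 - exp (- t)) / t"]) auto
  qed
  then show ?thesis by simp
qed

text \<open>On \<open>{x..y}\<close> the integrand is at least \<open>exp (- y) / t\<close>. This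
  gives the blow-up of \<open>E1\<close> at 0 as well as its lower bound for large
  arguments.\<close>

lemma E1_diff_ge_ln:
  assumes "0 < x" "x \<le> y"
  shows "exp (- y) * (ln y - ln x) \<le> E1 x - E1 y"
proof -
  have "(\<lambda>t. E1 t + exp (- y) * ln t) x \<ge> (\<lambda>t. E1 t + exp (- y) * ln t) y"
  proof (rule DERIV_nonpos_imp_nonincreasing[OF assms(2)])
    fix t assume t: "x \<le> t" "t \<le> y"
    then have "((\<lambda>t. E1 t + exp (- y) * ln t) has_real_derivative (exp (- y) - exp (- t)) / t) (at t)"
      using assms by (auto intro!: derivative_eq_intros simp: field_simps)
    then show "\<exists>d. ((\<lambda>t. E1 t + exp (- y) * ln t) has_real_derivative d) (at t) \<and> d \<le> 0"
      using t assms by (intro exI[of _ "(exp (- y) - exp (- t)) / t"]) (auto intro: divide_nonpos_pos)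
  qed
  then show ?thesis by (simp add: algebra_simps)
qed

text \<open>Keeps only the part of the integral over \<open>{x..x+1}\<close>; the logarithm there is
  estimated by \<open>ln z \<le> z - 1\<close> at \<open>z = x / (x + 1)\<close>.\<close>

lemma E1_ge:
  assumes "0 < x"
  shows "exp (- (x + 1)) / (x + 1) \<le> E1 x"
proof -
  have "exp (- (x + 1)) * (1 / (x + 1)) \<le> exp (- (x + 1)) * (ln (x + 1) - ln x)"
  proof (intro mult_left_mono)
    have "ln (x / (x + 1)) \<le> x / (x + 1) - 1"
      using assms by (intro ln_le_minus_one) auto
    then show "1 / (x + 1) \<le> ln (x + 1) - ln x"
      using assms by (simp add: ln_div field_simps)
  qed simp
  also have "\<dots> \<le> E1 x"
    using E1_diff_ge_ln[of x "x + 1"] E1_nonneg[of "x + 1"] assms by simp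
  finally show ?thesis by simp
qed

section \<open>The inverse of \<open>E1\<close> and the rescaled map\<close>

lemma E1_surj:
  assumes "0 < y"
  shows "\<exists>x>0. E1 x = y"
proof -
  \<comment> \<open>Endpoints for the intermediate value theorem: \<open>a\<close> solves
    \<open>exp (- 1) * (ln 1 - ln a) = y\<close>, the lower bound for \<open>E1 a\<close> from the
    interval \<open>{a..1}\<close>, and \<open>b\<close> turns the upper bound
    \<open>exp (- b) / b\<close> into \<open>exp (- b) * y\<close>.\<close>
  define a where "a = exp (- y * exp 1)"
  define b where "b = 1 / y"
  have a: "0 < a" "a \<le> 1" and b: "0 < b"
    using assms by (auto simp: a_def b_def)
  have "y = exp (- 1) * (ln 1 - ln a)"
    by (simp add: a_def flip: exp_add)
  also have "\<dots> \<le> E1 a"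
    using E1_diff_ge_ln[OF a] E1_nonneg[of 1] by simp
  finally have ya: "y \<le> E1 a" .
  have "E1 b \<le> exp (- b) * y"
    using E1_le[OF b] by (simp add: b_def)
  also have "\<dots> < 1 * y"
    using assms b by (intro mult_strict_right_mono) auto
  finally have yb: "E1 b < y" by simp
  then have "a \<le> b"
    using ya a b E1_less_iff[of b a] by linarith
  then obtain x where "a \<le> x" "E1 x = y"
    using IVT2[of E1 b y a] yb ya a E1_isCont by fastforce
  then show ?thesis using a by (intro exI[of _ x]) auto
qed

lemma E1_inj_on: "inj_on E1 {0<..}"
  by (rule inj_onI) (metis E1_less_iff greaterThan_iff less_irrefl linorder_neqE_linordered_idom)

lemma E1_inv_E1: "0 < x \<Longrightarrow> E1_inv (E1 x) = x"
  unfolding E1_inv_def by (intro the_inv_into_f_f E1_inj_on) auto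

lemma E1_inv_pos: "0 < y \<Longrightarrow> 0 < E1_inv y"
  and E1_E1_inv: "0 < y \<Longrightarrow> E1 (E1_inv y) = y"
  using E1_surj[of y] E1_inv_E1 by auto

lemma E1_inv_antimono: "0 < x \<Longrightarrow> x \<le> y \<Longrightarrow> E1_inv y \<le> E1_inv x"
  using E1_less_iff[of "E1_inv y" "E1_inv x"] E1_inv_pos[of x] E1_inv_pos[of y]
    E1_E1_inv[of x] E1_E1_inv[of y] by linarith

lemma E1_inv_deriv:
  assumes "0 < y"
  shows "(E1_inv has_real_derivative - (E1_inv y * exp (E1_inv y))) (at y)"
proof -
  let ?u = "E1_inv y"
  have u: "0 < ?u" using E1_inv_pos assms .
  have "isCont E1_inv (E1 ?u)"
  \<comment> \<open>Continuity of the inverse, needed for the inverse function rule, follows from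
    continuity and invertibility of \<open>E1\<close> on an interval around \<open>?u\<close> inside
    the positive reals.\<close>
  proof (rule isCont_inverse_function2[of "?u / 2" _ "?u + 1" E1_inv E1])
    fix z assume "?u / 2 \<le> z"
    then have "0 < z" using u by linarith
    then show "E1_inv (E1 z) = z" "isCont E1 z" by (rule E1_inv_E1 E1_isCont)+
  qed (use u in linarith)+
  then have "(E1_inv has_real_derivative inverse (- (exp (- ?u) / ?u))) (at y)"
    using u assms by (intro DERIV_inverse_function[of E1 _ _ _ 0 "y + 1"] E1_deriv)
      (auto simp: E1_E1_inv)
  moreover have "inverse (- (exp (- ?u) / ?u)) = - (?u * exp ?u)"
    by (simp add: exp_minus field_simps)
  ultimately show ?thesis by simp
qed

text \<open>The factor \<open>u * exp u\<close> from the inverse meets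
  \<open>exp (- (u * k)) / (u * k)\<close> from \<open>E1\<close>; with the inner factors
  \<open>k\<close> and \<open>1 / c\<close> everything but the exponentials cancels.\<close>

lemma E1_rescale_deriv:
  assumes "0 < x" "0 < c" "0 < k"
  shows "((\<lambda>x. c * E1 (E1_inv (x / c) * k)) has_real_derivative
    exp ((1 - k) * E1_inv (x / c))) (at x)"
proof -
  let ?u = "E1_inv (x / c)"
  have u: "0 < ?u" using assms by (simp add: E1_inv_pos)
  have "((\<lambda>x. E1_inv (x / c)) has_real_derivative - (?u * exp ?u) * (1 / c)) (at x)"
    using assms by (intro DERIV_chain2[OF E1_inv_deriv]) (auto intro!: derivative_eq_intros)
  then have "((\<lambda>x. c * E1 (E1_inv (x / c) * k)) has_real_derivative
      c * (- (exp (- (?u * k)) / (?u * k)) * (- (?u * exp ?u) * (1 / c) * k))) (at x)"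
    using u assms by (auto intro!: derivative_eq_intros)
  moreover have "c * (- (exp (- (?u * k)) / (?u * k)) * (- (?u * exp ?u) * (1 / c) * k))
      = exp ((1 - k) * ?u)"
  proof -
    have "exp ((1 - k) * ?u) = exp (- (?u * k)) * exp ?u"
      by (simp add: algebra_simps flip: exp_add)
    then show ?thesis using u assms by simp
  qed
  ultimately show ?thesis by simp
qed

section \<open>General criteria on the half-line\<close>

lemma mono_concave_on_atLeast_0:
  fixes f :: "real \<Rightarrow> real"
  assumes f0: "f 0 = 0" and nonneg: "\<And>x. 0 < x \<Longrightarrow> 0 \<le> f x"
    and deriv: "\<And>x. 0 < x \<Longrightarrow> (f has_real_derivative f' x) (at x)"
    and f': "\<And>x. 0 < x \<Longrightarrow> 0 \<le> f' x" "\<And>x y. 0 < x \<Longrightarrow> x \<le> y \<Longrightarrow> f' y \<le> f' x"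
  shows "mono_on {0..} f" "concave_on {0..} f"
proof -
  show "mono_on {0..} f"
  proof (rule mono_onI)
    fix x y :: real assume *: "x \<in> {0..}" "y \<in> {0..}" "x \<le> y"
    show "f x \<le> f y"
    proof (cases "x = 0")
      case True
      then show ?thesis using * f0 nonneg[of y] by (cases "y = 0") auto
    next
      case False
      then show ?thesis
        using * by (intro DERIV_nonneg_imp_nondecreasing[of x y f]) (force intro: deriv f')+
    qed
  qed
  have conv: "convex_on {0<..} (\<lambda>x. - f x)"
    by (rule convex_on_realI[where f' = "\<lambda>x. - f' x"])
       (auto intro!: derivative_eq_intros deriv f' simp: connected_iff_interval)
  \<comment> \<open>Continuity at 0 is not assumed; the endpoint is reached by letting \<open>e\<close> tend to 0 in the
    concavity inequality on \<open>{e..y}\<close>, discarding \<open>f e \<ge> 0\<close>.\<close>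
  have zero: "t * f y \<le> f (t * y)" if "0 < t" "t < 1" "0 < y" for t y
  proof (rule tendsto_upperbound)
    show "((\<lambda>e. (t * y - e) / (y - e) * f y) \<longlongrightarrow> t * f y) (at_right 0)"
      using that by (auto intro!: tendsto_eq_intros)
    have "(t * y - e) / (y - e) * f y \<le> f (t * y)" if e: "0 < e" "e < t * y" for e
    proof -
      \<comment> \<open>The weight that writes \<open>t * y\<close> as the convex combination
        \<open>(1 - s) * e + s * y\<close>; it tends to \<open>t\<close> as \<open>e\<close> tends
        to 0.\<close>
      define s where "s = (t * y - e) / (y - e)"
      have ty: "t * y < y" using \<open>0 < y\<close> \<open>t < 1\<close> by simp
      then have s: "0 \<le> s" "s \<le> 1" using e ty \<open>t < 1\<close> by (auto simp: s_def field_simps)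
      have "s * (y - e) = t * y - e" using e ty by (simp add: s_def)
      then have "(1 - s) * e + s * y = t * y" by (simp add: algebra_simps)
      then have "- f (t * y) \<le> (1 - s) * (- f e) + s * (- f y)"
        using convex_onD[OF conv s, of e y] e \<open>0 < y\<close> by simp
      moreover have "0 \<le> (1 - s) * f e" using s nonneg[of e] e by simp
      ultimately show ?thesis by (simp add: s_def)
    qed
    then show "\<forall>\<^sub>F e in at_right 0. (t * y - e) / (y - e) * f y \<le> f (t * y)"
      using that by (auto simp: eventually_at_right_field intro!: exI[of _ "t * y"])
  qed simp
  show "concave_on {0..} f"
    unfolding concave_on_def
  \<comment> \<open>With \<open>x < y\<close> only the smaller point can be 0, and that case is
    \<open>zero\<close>.\<close>
  proof (rule convex_on_linorderI)
    fix t x y :: real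
    assume *: "0 < t" "t < 1" "x \<in> {0..}" "y \<in> {0..}" "x < y"
    show "- f ((1 - t) *\<^sub>R x + t *\<^sub>R y) \<le> (1 - t) * - f x + t * - f y"
    proof (cases "x = 0")
      case True
      then show ?thesis using zero[of t y] * f0 by simp
    next
      case False
      then show ?thesis using convex_onD[OF conv, of t x y] * by simp
    qed
  qed simp
qed

text \<open>Split at \<open>d\<close>: below, the quotient is at most
  \<open>A / 2 * y powr (a - 3 / 2)\<close> with exponent above -1; beyond, at most
  \<open>M / 2 * y powr (- 3 / 2)\<close>.\<close>

lemma set_integrable_div_powr_three_halves:
  fixes f :: "real \<Rightarrow> real"
  assumes cont: "continuous_on {0<..} f" and nonneg: "\<And>x. 0 < x \<Longrightarrow> 0 \<le> f x"
    and bdd: "\<And>x. 0 < x \<Longrightarrow> f x \<le> M"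
    and near0: "1 / 2 < a" "0 < d" "\<And>x. 0 < x \<Longrightarrow> x \<le> d \<Longrightarrow> f x \<le> A * x powr a"
  shows "set_integrable lborel {0<..} (\<lambda>y. f y / (2 * y powr (3 / 2)))"
proof -
  let ?h = "\<lambda>y. f y / (2 * y powr (3 / 2))"
  have meas: "set_borel_measurable lborel S ?h" if "S \<in> sets borel" "S \<subseteq> {0<..}" for S
  proof -
    have "continuous_on S ?h"
      using that by (intro continuous_intros continuous_on_subset[OF cont]) auto
    from borel_measurable_continuous_on_indicator[OF that(1) this] show ?thesis
      by (simp add: set_borel_measurable_def)
  qed
  have "set_integrable lborel {0<..d} (\<lambda>y. A / 2 * y powr (a - 3 / 2))"
  proof (rule set_integrable_mult_right, rule set_integrable_subset[where A = "{0..d}"])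
    show "set_integrable lborel {0..d} (\<lambda>y. y powr (a - 3 / 2))"
      using has_integral_powr_from_0[of "a - 3 / 2" d] near0
      by (intro nonneg_integrable_on_imp_set_integrable_lborel)
         (auto simp: set_borel_measurable_def integrable_on_def)
  qed auto
  then have 1: "set_integrable lborel {0<..d} ?h"
  proof (rule set_integrable_bound)
    have "norm (?h y) \<le> norm (A / 2 * y powr (a - 3 / 2))" if "0 < y" "y \<le> d" for y
    proof -
      have "?h y \<le> A * y powr a / (2 * y powr (3 / 2))"
        using that near0(3)[of y] by (intro divide_right_mono) auto
      also have "\<dots> = A / 2 * y powr (a - 3 / 2)"
        using that by (simp add: powr_diff)
      finally show ?thesis using nonneg[of y] that by simp
    qed
    then show "AE y in lborel. y \<in> {0<..d} \<longrightarrow> norm (?h y) \<le> norm (A / 2 * y powr (a - 3 / 2))"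
      by auto
  qed (auto intro: meas)
  have "set_integrable lborel {d..} (\<lambda>y. M / 2 * y powr (- 3 / 2))"
    using has_integral_powr_to_inf[of "- 3 / 2" d] near0
    by (intro set_integrable_mult_right nonneg_integrable_on_imp_set_integrable_lborel)
       (auto simp: set_borel_measurable_def integrable_on_def)
  then have 2: "set_integrable lborel {d..} ?h"
  proof (rule set_integrable_bound)
    have "norm (?h y) \<le> norm (M / 2 * y powr (- 3 / 2))" if "d \<le> y" for y
    proof -
      have "?h y \<le> M / (2 * y powr (3 / 2))"
        using that bdd[of y] near0 by (intro divide_right_mono) auto
      also have "\<dots> = M / 2 * y powr (- 3 / 2)"
        by (simp add: powr_minus divide_simps)
      finally show ?thesis using nonneg[of y] that near0 by simp
    qed
    then show "AE y in lborel. y \<in> {d..} \<longrightarrow> norm (?h y) \<le> norm (M / 2 * y powr (- 3 / 2))"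
      by auto
  qed (use near0 in \<open>auto intro!: meas\<close>)
  have "{0<..d} \<union> {d..} = {0<..}" using near0 by auto
  then show ?thesis using set_integrable_Un[OF 1 2] by simp
qed

lemma bounded_image_atLeast_0:
  fixes f :: "real \<Rightarrow> real"
  assumes "f 0 = 0" "\<And>x. 0 < x \<Longrightarrow> 0 \<le> f x" "\<And>x. 0 < x \<Longrightarrow> f x \<le> M"
  shows "bounded (f ` {0..})"
proof -
  have "\<bar>f x\<bar> \<le> \<bar>M\<bar>" if "0 \<le> x" for x
    using assms(1) assms(2,3)[of x] that by (cases "x = 0") auto
  then show ?thesis by (auto intro!: boundedI)
qed

section \<open>Power bound for \<open>E1\<close> at a rescaled point\<close>

text \<open>The upper bound for \<open>E1 (u * k)\<close> and the \<open>k\<close>-th power of the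
  lower bound for \<open>E1 u\<close> both decay like \<open>exp (- (u * k))\<close>. The shift by 1
  in the lower bound costs \<open>exp k\<close>; the 2 comes from
  \<open>(u + 1) powr k \<le> u + 1 \<le> 2 * u\<close>.\<close>

lemma E1_mult_le:
  assumes "0 < k" "k \<le> 1" "1 \<le> u"
  shows "E1 (u * k) \<le> 2 * exp k / k * E1 u powr k"
proof -
  have "(u + 1) powr k \<le> (u + 1) powr 1"
    using assms by (intro powr_mono) auto
  then have "(u + 1) powr k \<le> 2 * u" using assms by simp
  then have "1 / u \<le> 2 / (u + 1) powr k"
    using assms by (simp add: field_simps)
  then have "exp (- (u * k)) / k * (1 / u) \<le> exp (- (u * k)) / k * (2 / (u + 1) powr k)"
    using assms by (intro mult_left_mono) auto
  then have "E1 (u * k) \<le> exp (- (u * k)) / k * (2 / (u + 1) powr k)"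
    using E1_le[of "u * k"] assms by (simp add: mult_ac)
  also have "\<dots> = 2 * exp k / k * (exp (- (u + 1)) / (u + 1)) powr k"
  proof -
    have "(exp (- (u + 1)) / (u + 1)) powr k = exp (- (u * k)) * exp (- k) / (u + 1) powr k"
      using assms by (simp add: powr_divide exp_powr_real algebra_simps flip: exp_add)
    moreover have "2 * exp k / k * (exp (- (u * k)) * exp (- k) / (u + 1) powr k)
        = (exp k * exp (- k)) * (exp (- (u * k)) / k * (2 / (u + 1) powr k))"
      by simp
    moreover have "exp k * exp (- k) = 1" by (simp flip: exp_add)
    ultimately show ?thesis by (simp only: mult_1_left)
  qed
  also have "\<dots> \<le> 2 * exp k / k * E1 u powr k"
    using assms E1_ge[of u] by (intro mult_left_mono powr_mono2) auto
  finally show ?thesis .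
qed

section \<open>The functions \<open>Upsilon_plus\<close> and \<open>Upsilon_minus\<close>\<close>

text \<open>Covers ratios \<open>b / bbar\<close> on both sides of 1, so that a change of sign
  yields the derivative of \<open>Upsilon_minus\<close> too.\<close>

lemma Upsilon_plus_deriv:
  assumes "0 < b" "0 < bbar" "0 < c" "0 < x"
  shows "(Upsilon_plus b bbar c c has_real_derivative
    exp ((1 - b / bbar) * E1_inv (x / c)) - 1) (at x)"
proof -
  have "((\<lambda>x. c * E1 (E1_inv (x / c) * (b / bbar)) - x) has_real_derivative
      exp ((1 - b / bbar) * E1_inv (x / c)) - 1) (at x)"
    using assms by (intro derivative_intros E1_rescale_deriv) auto
  then show ?thesis
    by (rule has_field_derivative_transform_within_open[where S = "{0<..}"])
       (use assms in \<open>auto simp: Upsilon_plus_def\<close>)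
qed

lemma Upsilon_minus_eq: "Upsilon_minus b bbar c cbar x = - Upsilon_plus b bbar c cbar x"
  by (simp add: Upsilon_minus_def Upsilon_plus_def)

text \<open>Since \<open>x = c * E1 (E1_inv (x / c))\<close>, equal constants \<open>c\<close> turn
  the function into a difference of \<open>E1\<close> at two points of fixed ratio, ready for
  monotonicity and the logarithmic bound.\<close>

lemma Upsilon_plus_eq:
  assumes "0 < c" "0 < x"
  shows "Upsilon_plus b bbar c c x
    = c * (E1 (E1_inv (x / c) * (b / bbar)) - E1 (E1_inv (x / c)))"
  using assms by (simp add: Upsilon_plus_def E1_E1_inv algebra_simps)

lemma Upsilon_plus_properties:
  assumes "0 < b" "0 < bbar" "0 < c" "b \<le> bbar" "bbar / 2 < b"
  defines "U \<equiv> Upsilon_plus b bbar c c"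
  shows "bounded (U ` {0..})" "mono_on {0..} U" "concave_on {0..} U"
    "set_integrable lborel {0<..} (\<lambda>y. U y / (2 * y powr (3 / 2)))"
proof -
  note pos = assms(1-5)
  define k where "k = b / bbar"
  have k: "0 < k" "k \<le> 1" "1 / 2 < k"
    using pos by (auto simp: k_def field_simps)
  have U0: "U 0 = 0" by (simp add: U_def Upsilon_plus_def)
  have u: "0 < E1_inv (x / c)" if "0 < x" for x
    using that pos by (simp add: E1_inv_pos)
  have le: "E1_inv (x / c) * k \<le> E1_inv (x / c)" if "0 < x" for x
    using u[OF that] k by simp
  have U_eq: "U x = c * (E1 (E1_inv (x / c) * k) - E1 (E1_inv (x / c)))" if "0 < x" for x
    using that pos by (simp add: U_def k_def Upsilon_plus_eq)
  have nonneg: "0 \<le> U x" if "0 < x" for x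
    using E1_antimono[OF _ le[OF that]] u[OF that] k pos by (simp add: U_eq[OF that])
  have bdd: "U x \<le> c * - ln k" if "0 < x" for x
    unfolding U_eq[OF that]
    using E1_diff_le_ln[OF _ le[OF that]] u[OF that] k pos
    by (intro mult_left_mono) (auto simp: ln_mult)
  have deriv: "(U has_real_derivative exp ((1 - k) * E1_inv (x / c)) - 1) (at x)" if "0 < x" for x
    unfolding U_def k_def using that pos by (intro Upsilon_plus_deriv)
  have d1: "0 \<le> exp ((1 - k) * E1_inv (x / c)) - 1" if "0 < x" for x
    using u[OF that] k by simp
  have d2: "exp ((1 - k) * E1_inv (y / c)) - 1 \<le> exp ((1 - k) * E1_inv (x / c)) - 1"
    if "0 < x" "x \<le> y" for x y
    using E1_inv_antimono[of "x / c" "y / c"] that pos k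
    by (simp add: divide_right_mono mult_left_mono)
  show "bounded (U ` {0..})" by (rule bounded_image_atLeast_0[where f = U, OF U0 nonneg bdd])
  show "mono_on {0..} U" "concave_on {0..} U"
    using mono_concave_on_atLeast_0[where f = U, OF U0 nonneg deriv d1 d2] by auto
  \<comment> \<open>\<open>x \<le> c * E1 1\<close> says exactly that \<open>E1_inv (x / c)\<close>
    is at least 1, the range of \<open>E1_mult_le\<close>; the constant collects its factor and the
    powers of \<open>c\<close>.\<close>
  have near0: "U x \<le> c * (2 * exp k / k) / c powr k * x powr k"
    if x: "0 < x" "x \<le> c * E1 1" for x
  proof -
    have "\<not> E1_inv (x / c) < 1"
      using x pos E1_less_iff[of 1 "E1_inv (x / c)"] u[of x]
      by (simp add: E1_E1_inv field_simps)
    then have "E1 (E1_inv (x / c) * k) \<le> 2 * exp k / k * (x / c) powr k"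
      using E1_mult_le[of k "E1_inv (x / c)"] k x pos by (simp add: E1_E1_inv)
    moreover have "U x \<le> c * E1 (E1_inv (x / c) * k)"
      using E1_pos[OF u[of x]] x pos by (simp add: U_eq)
    ultimately have "U x \<le> c * (2 * exp k / k * (x / c) powr k)"
      using pos by (meson mult_left_mono less_imp_le order_trans)
    also have "\<dots> = c * (2 * exp k / k) / c powr k * x powr k"
      using x pos by (simp add: powr_divide)
    finally show ?thesis .
  qed
  show "set_integrable lborel {0<..} (\<lambda>y. U y / (2 * y powr (3 / 2)))"
  proof (rule set_integrable_div_powr_three_halves[where f = U, OF _ nonneg bdd k(3) _ near0])
    show "continuous_on {0<..} U"
      using deriv by (intro continuous_at_imp_continuous_on) (auto intro: DERIV_isCont)
    show "0 < c * E1 1" using pos by (simp add: E1_pos)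
  qed
qed

lemma Upsilon_minus_properties:
  assumes "0 < b" "0 < bbar" "0 < c" "bbar \<le> b"
  defines "U \<equiv> Upsilon_minus b bbar c c"
  shows "bounded (U ` {0..})" "mono_on {0..} U" "concave_on {0..} U"
    "set_integrable lborel {0<..} (\<lambda>y. U y / (2 * y powr (3 / 2)))"
    "\<forall>x\<ge>0. U x \<le> x"
proof -
  note pos = assms(1-4)
  define k where "k = b / bbar"
  have k: "1 \<le> k" using pos by (auto simp: k_def field_simps)
  have U0: "U 0 = 0" by (simp add: U_def Upsilon_minus_def)
  have u: "0 < E1_inv (x / c)" if "0 < x" for x
    using that pos by (simp add: E1_inv_pos)
  have le: "E1_inv (x / c) \<le> E1_inv (x / c) * k" if "0 < x" for x
    using u[OF that] k by simp
  have U_eq: "U x = c * (E1 (E1_inv (x / c)) - E1 (E1_inv (x / c) * k))" if "0 < x" for x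
    using that pos by (simp add: U_def k_def Upsilon_minus_eq Upsilon_plus_eq algebra_simps)
  have nonneg: "0 \<le> U x" if "0 < x" for x
    using E1_antimono[OF u le, OF that that] pos by (simp add: U_eq[OF that])
  have bdd: "U x \<le> c * ln k" if "0 < x" for x
    unfolding U_eq[OF that]
    using E1_diff_le_ln[OF u le, OF that that] u[OF that] k pos
    by (intro mult_left_mono) (auto simp: ln_mult)
  have deriv: "(U has_real_derivative 1 - exp ((1 - k) * E1_inv (x / c))) (at x)" if "0 < x" for x
    using DERIV_minus[OF Upsilon_plus_deriv[of b bbar c x]] that pos
    by (simp add: U_def k_def Upsilon_minus_eq[abs_def])
  have d1: "0 \<le> 1 - exp ((1 - k) * E1_inv (x / c))" if "0 < x" for x
    using u[OF that] k by (simp add: mult_nonpos_nonneg)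
  have d2: "1 - exp ((1 - k) * E1_inv (y / c)) \<le> 1 - exp ((1 - k) * E1_inv (x / c))"
    if "0 < x" "x \<le> y" for x y
    using E1_inv_antimono[of "x / c" "y / c"] that pos k
    by (simp add: divide_right_mono mult_left_mono_neg)
  \<comment> \<open>\<open>U x\<close> arises from \<open>x\<close> by subtracting a nonnegative
    multiple of \<open>E1\<close>.\<close>
  have le_id: "U x \<le> x" if "0 < x" for x
    using E1_nonneg[of "E1_inv (x / c) * k"] u[OF that] k that pos
    by (simp add: U_def k_def Upsilon_minus_def)
  show "bounded (U ` {0..})" by (rule bounded_image_atLeast_0[where f = U, OF U0 nonneg bdd])
  show "mono_on {0..} U" "concave_on {0..} U"
    using mono_concave_on_atLeast_0[where f = U, OF U0 nonneg deriv d1 d2] by auto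
  show "\<forall>x\<ge>0. U x \<le> x" using le_id U0 by (metis order_le_less)
  show "set_integrable lborel {0<..} (\<lambda>y. U y / (2 * y powr (3 / 2)))"
  \<comment> \<open>\<open>le_id\<close> serves as the power bound near 0 with exponent 1; the
    splitting point 1 is arbitrary.\<close>
  proof (rule set_integrable_div_powr_three_halves[where f = U and a = 1 and d = 1 and A = 1, OF _ nonneg bdd])
    show "continuous_on {0<..} U"
      using deriv by (intro continuous_at_imp_continuous_on) (auto intro: DERIV_isCont)
  qed (auto simp: le_id)
qed

theorem proposition5p2:
  fixes b_p bbar_p b_n bbar_n c_p cbar_p c_n cbar_n :: real
    and Up Um :: "real \<Rightarrow> real"
  assumes "b_p > 0" "bbar_p > 0" "b_n > 0" "bbar_n > 0"
    and "c_p > 0" "cbar_p > 0" "c_n > 0" "cbar_n > 0"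
    and "bbar_p \<ge> b_p" "b_p > bbar_p / 2"
    and "c_p = cbar_p" "c_n = cbar_n"
    and "bbar_n \<le> b_n"
  defines "Up \<equiv> Upsilon_plus b_p bbar_p c_p cbar_p"
    and "Um \<equiv> Upsilon_minus b_n bbar_n c_n cbar_n"
  shows "bounded (Up ` {0..}) \<and> mono_on {0..} Up \<and> concave_on {0..} Up
    \<and> set_integrable lborel {0<..} (\<lambda>y. Up y / (2 * y powr (3 / 2)))
    \<and> bounded (Um ` {0..}) \<and> mono_on {0..} Um \<and> concave_on {0..} Um
    \<and> set_integrable lborel {0<..} (\<lambda>y. Um y / (2 * y powr (3 / 2)))
    \<and> (\<forall>x\<ge>0. Um x \<le> x)"
  unfolding Up_def Um_def \<open>c_p = cbar_p\<close>[symmetric] \<open>c_n = cbar_n\<close>[symmetric]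
  by (intro conjI Upsilon_plus_properties Upsilon_minus_properties assms)

end
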